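(* Let $G, H$ be perfect graphs on the vertex set $[d]$. Then $\mathcal{U}P_G$ is unimodularly equivalent to $\mathcal{U}P_H$ if and only if $G$ and $H$ are isomorphic.
   Context: For a graph $G=([d],E)$, $P_G=\mathrm{conv}\{\mathbf{1}_S: S\subseteq[d]\text{ stable set of }G\}\subset\mathbb{R}^d_+$ is its stable set polytope ($\mathbf{1}_S$ the characteristic vector). For an anti-blocking polytope $Q\subset\mathbb{R}^d_+$, $\mathcal{U}Q=\{\mathbf{p}\in\mathbb{R}^d:(|p_1|,\dots,|p_d|)\in Q\}$. A graph is perfect if clique number equals chromatic number for every induced subgraph. Two lattice polytopes $P,P'$ are unimodularly equivalent if $P'=T(P)$ for some $T(\mathbf{x})=W\mathbf{x}+\mathbf{v}$ with $W\in\mathrm{SL}_d(\mathbb{Z})$, $\mathbf{v}\in\mathbb{Z}^d$. *)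

theory Defs
  imports "HOL-Analysis.Analysis" "HOL-Library.Ramsey"
begin

text \<open>
  A graph is given by its vertex set and its set of edges, an edge being a two-element set of
  vertices, as in \<^theory>\<open>HOL-Library.Ramsey\<close>, which supplies \<^const>\<open>clique\<close> and
  \<^const>\<open>indep\<close> (stable sets).
\<close>

definition simple_graph :: "'a set \<Rightarrow> 'a set set \<Rightarrow> bool" where
  "simple_graph V E \<longleftrightarrow> finite V \<and> E \<subseteq> [V]\<^bsup>2\<^esup>"

definition induced_edges :: "'a set set \<Rightarrow> 'a set \<Rightarrow> 'a set set" where
  "induced_edges E U = {e \<in> E. e \<subseteq> U}"

definition clique_number :: "'a set \<Rightarrow> 'a set set \<Rightarrow> nat" where
  "clique_number V E = Max {card K | K. K \<subseteq> V \<and> clique K E}"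

definition proper_colouring :: "'a set \<Rightarrow> 'a set set \<Rightarrow> nat \<Rightarrow> ('a \<Rightarrow> nat) \<Rightarrow> bool" where
  "proper_colouring V E k c \<longleftrightarrow>
     c ` V \<subseteq> {..<k} \<and> (\<forall>u\<in>V. \<forall>v\<in>V. {u, v} \<in> E \<longrightarrow> c u \<noteq> c v)"

definition chromatic_number :: "'a set \<Rightarrow> 'a set set \<Rightarrow> nat" where
  "chromatic_number V E = (LEAST k. \<exists>c. proper_colouring V E k c)"

definition perfect_graph :: "'a set \<Rightarrow> 'a set set \<Rightarrow> bool" where
  "perfect_graph V E \<longleftrightarrow> simple_graph V E \<and>
     (\<forall>U\<subseteq>V. clique_number U (induced_edges E U) = chromatic_number U (induced_edges E U))"

definition graph_isomorphic ::
    "'a set \<Rightarrow> 'a set set \<Rightarrow> 'b set \<Rightarrow> 'b set set \<Rightarrow> bool" where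
  "graph_isomorphic V E V' E' \<longleftrightarrow>
     (\<exists>f. bij_betw f V V' \<and> (\<forall>u\<in>V. \<forall>v\<in>V. {u, v} \<in> E \<longleftrightarrow> {f u, f v} \<in> E'))"

definition char_vec :: "'n set \<Rightarrow> real ^ 'n" where
  "char_vec S = (\<chi> i. indicator S i)"

text \<open>
  The vertex set is the index type itself; \<open>\<real>\<^sup>d\<close> is \<open>real ^ 'n\<close> with \<open>d = CARD('n)\<close>.
\<close>

definition stable_set_polytope :: "'n::finite set set \<Rightarrow> (real ^ 'n) set" where
  "stable_set_polytope E = convex hull {char_vec S | S. indep S E}"

definition unconditional :: "(real ^ 'n) set \<Rightarrow> (real ^ 'n) set" where
  "unconditional Q = {p. (\<chi> i. \<bar>p $ i\<bar>) \<in> Q}"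

definition unimodularly_equivalent :: "(real ^ 'n::finite) set \<Rightarrow> (real ^ 'n) set \<Rightarrow> bool" where
  "unimodularly_equivalent P P' \<longleftrightarrow>
     (\<exists>(W :: int ^ 'n ^ 'n) (v :: int ^ 'n). det W = 1 \<and>
        P' = (\<lambda>x. map_matrix real_of_int W *v x + (\<chi> i. real_of_int (v $ i))) ` P)"

end

theory Submission
  imports Defs
begin

text \<open>
  The lattice points of
  \<open>\<U>P\<^sub>G\<close> are the vectors with entries in \<open>{-1,0,1}\<close> whose support is stable, and a unimodular
  equivalence fixes the origin and permutes the lattice points. If \<open>i\<close> and \<open>j\<close> are not adjacent,
  both \<open>e\<^sub>i + e\<^sub>j\<close> and \<open>e\<^sub>i - e\<^sub>j\<close> are lattice points, so the columns \<open>i\<close> and \<open>j\<close> of the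
  transformation matrix \<open>W\<close> have disjoint supports; the same holds for the inverse of \<open>W\<close>.
  As \<open>W e\<^sub>i\<close> has a stable support \<open>S\<close>, the vector \<open>e\<^sub>i\<close> is a signed sum of the columns of
  the inverse indexed by \<open>S\<close>, which are nonzero and have disjoint supports, so \<open>S\<close> is a singleton.
  Hence \<open>W\<close> is a signed permutation matrix, and its permutation is a graph isomorphism.
  Conversely, a graph isomorphism acts by a permutation matrix, whose determinant can be
  made \<open>1\<close> by a sign change in one coordinate, a symmetry of \<open>\<U>P\<^sub>H\<close>.
\<close>

definition real_vec :: "int ^ 'n \<Rightarrow> real ^ 'n" where
  "real_vec z = (\<chi> i. real_of_int (z $ i))"

text \<open>Combinatorial description of the lattice points of the unconditional polytope; it lets
  the later arguments run over integer vectors.\<close>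

definition signed_stable :: "'n set set \<Rightarrow> int ^ 'n \<Rightarrow> bool" where
  "signed_stable E z \<longleftrightarrow> (\<forall>i. \<bar>z $ i\<bar> \<le> 1) \<and> indep {i. z $ i \<noteq> 0} E"

section \<open>Lattice points\<close>

lemma stable_set_polytope_le_1:
  assumes "x \<in> stable_set_polytope E"
  shows "x $ i \<le> 1"
proof -
  have "convex {x :: real ^ 'a. x $ i \<le> 1}"
    by (auto simp: convex_def intro: convex_bound_le)
  then have "convex hull {char_vec S | S. indep S E} \<subseteq> {x. x $ i \<le> 1}"
    by (intro hull_minimal) (auto simp: char_vec_def indicator_def)
  with assms show ?thesis
    by (auto simp: stable_set_polytope_def)
qed

lemma stable_set_polytope_edge_le_1:
  assumes "x \<in> stable_set_polytope E" and "{i, j} \<in> E" and "i \<noteq> j"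
  shows "x $ i + x $ j \<le> 1"
proof -
  have "convex {x :: real ^ 'a. x $ i + x $ j \<le> 1}"
  proof (clarsimp simp: convex_def)
    fix x y :: "real ^ 'a" and u v :: real
    assume "x $ i + x $ j \<le> 1" "y $ i + y $ j \<le> 1" "0 \<le> u" "0 \<le> v" "u + v = 1"
    then have "u * (x $ i + x $ j) + v * (y $ i + y $ j) \<le> 1"
      by (intro convex_bound_le)
    then show "u * x $ i + v * y $ i + (u * x $ j + v * y $ j) \<le> 1"
      by (simp add: algebra_simps)
  qed
  then have "convex hull {char_vec S | S. indep S E} \<subseteq> {x. x $ i + x $ j \<le> 1}"
    using assms(2,3)
    by (intro hull_minimal) (auto simp: char_vec_def indicator_def indep_def)
  with assms(1) show ?thesis
    by (auto simp: stable_set_polytope_def)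
qed

lemma char_vec_in_stable_set_polytope:
  "indep S E \<Longrightarrow> char_vec S \<in> stable_set_polytope E"
  unfolding stable_set_polytope_def by (intro hull_inc) auto

text \<open>The bounds \<open>x $ i \<le> 1\<close> and the edge inequalities, applied to the
  entrywise absolute values, already force an integral point to be signed stable. Conversely those
  absolute values form a generator of the convex hull.\<close>

lemma real_vec_in_unconditional_stable_set_polytope_iff:
  "real_vec z \<in> unconditional (stable_set_polytope E) \<longleftrightarrow> signed_stable E z"
proof
  assume "real_vec z \<in> unconditional (stable_set_polytope E)"
  then have P: "(\<chi> i. \<bar>real_of_int (z $ i)\<bar>) \<in> stable_set_polytope E"
    by (simp add: unconditional_def real_vec_def)
  have "\<bar>z $ i\<bar> \<le> 1" for i
    using stable_set_polytope_le_1[OF P, of i] by simp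
  moreover have "indep {i. z $ i \<noteq> 0} E"
    unfolding indep_def
  proof (intro ballI impI notI)
    fix i j
    assume "i \<in> {i. z $ i \<noteq> 0}" "j \<in> {i. z $ i \<noteq> 0}" "i \<noteq> j" "{i, j} \<in> E"
    then show False
      using stable_set_polytope_edge_le_1[OF P, of i j] by simp
  qed
  ultimately show "signed_stable E z"
    by (simp add: signed_stable_def)
next
  assume z: "signed_stable E z"
  then have "\<bar>z $ i\<bar> \<le> 1" for i
    by (simp add: signed_stable_def)
  then have "\<bar>real_of_int (z $ i)\<bar> = indicator {i. z $ i \<noteq> 0} i" for i
  proof -
    from \<open>\<bar>z $ i\<bar> \<le> 1\<close> have "z $ i \<in> {-1, 0, 1}"
      by auto
    then show ?thesis
      by auto
  qed
  then have "(\<chi> i. \<bar>real_vec z $ i\<bar>) = char_vec {i. z $ i \<noteq> 0}"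
    by (simp add: vec_eq_iff real_vec_def char_vec_def)
  then show "real_vec z \<in> unconditional (stable_set_polytope E)"
    using z by (simp add: unconditional_def signed_stable_def char_vec_in_stable_set_polytope)
qed

lemma uminus_in_unconditional_iff [simp]: "- p \<in> unconditional Q \<longleftrightarrow> p \<in> unconditional Q"
  by (simp add: unconditional_def)

section \<open>Integer matrices of determinant one\<close>

lemma det_map_matrix_of_int:
  "det (map_matrix real_of_int W) = real_of_int (det W)"
  by (simp add: det_def map_matrix_def)

lemma real_vec_matrix_vector_mult:
  "real_vec (W *v z) = map_matrix real_of_int W *v real_vec z"
  by (simp add: real_vec_def matrix_vector_mult_def map_matrix_def vec_eq_iff)

lemma map_matrix_of_int_mult:
  "map_matrix real_of_int (A ** B) = map_matrix real_of_int A ** map_matrix real_of_int B"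
  by (simp add: matrix_matrix_mult_def map_matrix_def vec_eq_iff)

lemma map_matrix_of_int_eq_mat_1_iff:
  "map_matrix real_of_int A = mat 1 \<longleftrightarrow> A = mat 1"
  by (auto simp: map_matrix_def vec_eq_iff mat_def)

text \<open>As the determinant is 1, the inverse is the adjugate, whose entries are determinants of
  integer matrices.\<close>

lemma int_matrix_det_1_inverse:
  fixes W :: "int ^ 'n ^ 'n"
  assumes "det W = 1"
  obtains W' where "W ** W' = mat 1" "W' ** W = mat 1"
proof -
  \<comment> \<open>Numerators of Cramer's rule: column \<open>k\<close> of \<open>W\<close> is
    replaced by the unit vector at \<open>l\<close>.\<close>
  define W' :: "int ^ 'n ^ 'n"
    where "W' = (\<chi> k l. det (\<chi> i j. if j = k then axis l 1 $ i else W $ i $ j))"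
  let ?R = "map_matrix real_of_int"
  have det: "det (?R W) = 1"
    by (simp add: assms det_map_matrix_of_int)
  have col: "?R W *v column l (?R W') = axis l 1" for l
  proof -
    have "column l (?R W') = (\<chi> k. det (\<chi> i j. if j = k then axis l 1 $ i else ?R W $ i $ j) / det (?R W))"
    proof -
      have *: "?R (\<chi> i j. if j = k then axis l 1 $ i else W $ i $ j)
          = (\<chi> i j. if j = k then axis l 1 $ i else ?R W $ i $ j)" for k
        by (simp add: vec_eq_iff axis_def)
      have "column l (?R W') $ k = det (?R (\<chi> i j. if j = k then axis l 1 $ i else W $ i $ j))" for k
        by (simp add: column_def W'_def det_map_matrix_of_int)
      then show ?thesis
        by (simp add: det vec_eq_iff[of "column l (?R W')"] *)
    qed
    then show ?thesis
      using cramer[of "?R W" _ "axis l 1"] det by simp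
  qed
  have R: "?R W ** ?R W' = mat 1"
    using col by (simp add: vec_eq_iff matrix_matrix_mult_def matrix_vector_mult_def column_def
        mat_def axis_def)
  \<comment> \<open>Over the reals a right inverse is also a left inverse; both identities descend
    because the embedding of the integers is injective.\<close>
  then have "W ** W' = mat 1" "W' ** W = mat 1"
    using R matrix_left_right_inverse[THEN iffD1, OF R]
    by (simp_all flip: map_matrix_of_int_mult add: map_matrix_of_int_eq_mat_1_iff)
  then show thesis
    by (rule that)
qed

section \<open>From unimodular equivalences to isomorphisms\<close>

text \<open>Central symmetry forces the translation to vanish; what remains is an injective linear
  map of one polytope onto the other, so membership is preserved in both directions.\<close>

lemma unimodular_equivalence_signed_stable:
  fixes E F :: "'n::finite set set"
  assumes "unimodularly_equivalent
             (unconditional (stable_set_polytope E)) (unconditional (stable_set_polytope F))"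
  obtains W :: "int ^ 'n ^ 'n"
    where "det W = 1" "\<And>z. signed_stable F (W *v z) \<longleftrightarrow> signed_stable E z"
proof -
  let ?P = "unconditional (stable_set_polytope E)" and ?Q = "unconditional (stable_set_polytope F)"
  obtain W :: "int ^ 'n ^ 'n" and v :: "int ^ 'n" where W: "det W = 1"
    and Q: "?Q = (\<lambda>x. map_matrix real_of_int W *v x + real_vec v) ` ?P"
    using assms unfolding unimodularly_equivalent_def real_vec_def by blast
  let ?R = "map_matrix real_of_int W"
  have zero: "signed_stable D 0" for D :: "'n set set"
    by (simp add: signed_stable_def indep_def)
  have real_vec_0: "real_vec 0 = (0 :: real ^ 'n)"
    by (simp add: real_vec_def vec_eq_iff)
  have "0 \<in> ?P" "0 \<in> ?Q"
    using zero real_vec_in_unconditional_stable_set_polytope_iff[of 0 E]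
      real_vec_in_unconditional_stable_set_polytope_iff[of 0 F] by (simp_all add: real_vec_0)
  from \<open>0 \<in> ?Q\<close> obtain p where p: "p \<in> ?P" "?R *v p + real_vec v = 0"
    unfolding Q by force
  \<comment> \<open>Central symmetry: the image of \<open>- p\<close> is \<open>2 v\<close>, too long for an integral \<open>v \<noteq> 0\<close>.\<close>
  have "?R *v (- p) + real_vec v \<in> ?Q"
    unfolding Q using p(1) by (intro imageI) simp
  moreover have "?R *v (- p) + real_vec v = real_vec (v + v)"
  proof -
    have "?R *v (- p) = - (?R *v p)"
      by (simp add: matrix_vector_mult_def vec_eq_iff sum_negf)
    then have "?R *v (- p) = real_vec v"
      using p(2) by (simp add: add_eq_0_iff2)
    then show ?thesis
      by (simp add: real_vec_def vec_eq_iff)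
  qed
  ultimately have "signed_stable F (v + v)"
    by (simp add: real_vec_in_unconditional_stable_set_polytope_iff)
  then have "\<bar>v $ i + v $ i\<bar> \<le> 1" for i
    by (simp add: signed_stable_def)
  then have "v $ i = 0" for i
    by (smt (verit))
  then have "real_vec v = 0"
    by (simp add: real_vec_def vec_eq_iff)
  then have Q': "?Q = (\<lambda>x. ?R *v x) ` ?P"
    using Q by simp
  have "inj (\<lambda>x. ?R *v x)"
    using W by (intro inj_matrix_vector_mult) (simp add: invertible_det_nz det_map_matrix_of_int)
  then have "?R *v x \<in> ?Q \<longleftrightarrow> x \<in> ?P" for x
    unfolding Q' by (simp add: inj_image_mem_iff)
  then have "signed_stable F (W *v z) \<longleftrightarrow> signed_stable E z" for z
    by (simp add: real_vec_matrix_vector_mult flip: real_vec_in_unconditional_stable_set_polytope_iff)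
  with W show thesis
    by (rule that)
qed

lemma signed_stable_axis: "signed_stable E (axis i 1)"
  by (simp add: signed_stable_def indep_def axis_def)

text \<open>Lattice points detect adjacency. The signs are free so that the images of such vectors
  under a signed permutation are covered too.\<close>

lemma signed_stable_axis_add_iff:
  assumes "\<bar>a\<bar> = 1" "\<bar>b\<bar> = 1" "i \<noteq> j"
  shows "signed_stable E (axis i a + axis j b) \<longleftrightarrow> {i, j} \<notin> E"
proof -
  have "{k. (axis i a + axis j b) $ k \<noteq> 0} = {i, j}"
    using assms by (auto simp: axis_def split: if_splits)
  moreover have "\<bar>(axis i a + axis j b) $ k\<bar> \<le> 1" for k
    using assms by (simp add: axis_def)
  moreover have "indep {i, j} E \<longleftrightarrow> {i, j} \<notin> E"
    using \<open>i \<noteq> j\<close> by (auto simp: indep_def doubleton_eq_iff insert_commute[of j i])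
  ultimately show ?thesis
    by (simp add: signed_stable_def)
qed

lemma matrix_vector_mult_axis_nth:
  fixes W :: "'a::comm_semiring_1 ^ 'n ^ 'm"
  shows "(W *v axis i a) $ k = W $ k $ i * a"
  by (simp add: matrix_vector_mult_def axis_def if_distrib cong: if_cong)

lemma columns_disjoint_support:
  fixes W :: "int ^ 'n ^ 'n"
  assumes W: "\<And>z. signed_stable E z \<Longrightarrow> signed_stable F (W *v z)"
    and "i \<noteq> j" "{i, j} \<notin> E"
  shows "W $ k $ i = 0 \<or> W $ k $ j = 0"
proof -
  have "signed_stable F (W *v (axis i 1 + axis j b))" if "\<bar>b\<bar> = 1" for b
    using assms that by (intro W) (simp add: signed_stable_axis_add_iff)
  \<comment> \<open>The larger of |a + b| and |a - b| is |a| + |b|, so two integers with both at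
    most 1 cannot both be nonzero.\<close>
  from this[of 1] this[of "-1"]
  have "\<bar>W $ k $ i + W $ k $ j\<bar> \<le> 1" "\<bar>W $ k $ i - W $ k $ j\<bar> \<le> 1"
    by (auto simp: signed_stable_def matrix_vector_right_distrib matrix_vector_mult_axis_nth)
  then show ?thesis
    by linarith
qed

lemma column_support_singleton:
  fixes W W' :: "int ^ 'n ^ 'n"
  assumes W: "\<And>z. signed_stable E z \<Longrightarrow> signed_stable F (W *v z)"
    and W': "\<And>z. signed_stable F z \<Longrightarrow> signed_stable E (W' *v z)"
    and inv: "W ** W' = mat 1" "W' ** W = mat 1"
  shows "\<exists>!k. W $ k $ i \<noteq> 0"
proof -
  have W'W: "(\<Sum>m\<in>UNIV. W' $ a $ m * W $ m $ l) = (if a = l then 1 else 0)" for a l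
    using inv(2) by (simp add: vec_eq_iff matrix_matrix_mult_def mat_def)
  have WW': "(\<Sum>m\<in>UNIV. W $ a $ m * W' $ m $ l) = (if a = l then 1 else 0)" for a l
    using inv(1) by (simp add: vec_eq_iff matrix_matrix_mult_def mat_def)
  have "indep {k. W $ k $ i \<noteq> 0} F"
    using W[OF signed_stable_axis, of i]
    by (simp add: signed_stable_def matrix_vector_mult_axis_nth)
  then have disj: "W' $ a $ k = 0 \<or> W' $ a $ l = 0"
    if "W $ k $ i \<noteq> 0" "W $ l $ i \<noteq> 0" "k \<noteq> l" for a k l
    using that by (intro columns_disjoint_support[OF W']) (auto simp: indep_def)
  have row: "W' $ i $ k \<noteq> 0" if k: "W $ k $ i \<noteq> 0" for k
  proof -
    \<comment> \<open>Column \<open>k\<close> of the invertible matrix \<open>W'\<close> is nonzero.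
      It turns out that its only possible nonzero row is \<open>i\<close>, so any two columns of
      \<open>W'\<close> indexed by the support meet in row \<open>i\<close>, against
      \<open>disj\<close>.\<close>
    obtain a where a: "W' $ a $ k \<noteq> 0"
      using WW'[of k k] by force
    \<comment> \<open>Disjointness rules out cancellation: in row \<open>a\<close> only the term
      \<open>m = k\<close> survives, so entry \<open>(a, i)\<close> of the identity is
      nonzero.\<close>
    have "(\<Sum>m\<in>UNIV. W' $ a $ m * W $ m $ i) = (\<Sum>m\<in>{k}. W' $ a $ m * W $ m $ i)"
      using disj[OF k] a by (intro sum.mono_neutral_right) auto
    then have "a = i"
      using W'W[of a i] a k by (auto split: if_splits)
    with a show ?thesis
      by simp
  qed
  moreover obtain k where "W $ k $ i \<noteq> 0"
    using W'W[of i i] by force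
  ultimately show ?thesis
    using disj by blast
qed

lemma graph_isomorphic_if_unimodularly_equivalent:
  fixes E F :: "'n::finite set set"
  assumes "simple_graph UNIV E" "simple_graph UNIV F"
    and "unimodularly_equivalent
           (unconditional (stable_set_polytope E)) (unconditional (stable_set_polytope F))"
  shows "graph_isomorphic UNIV E UNIV F"
proof -
  obtain W :: "int ^ 'n ^ 'n"
    where "det W = 1" and W: "\<And>z. signed_stable F (W *v z) \<longleftrightarrow> signed_stable E z"
    using unimodular_equivalence_signed_stable[OF assms(3)] by blast
  then obtain W' where inv: "W ** W' = mat 1" "W' ** W = mat 1"
    using int_matrix_det_1_inverse by blast
  have W': "signed_stable E (W' *v z) \<longleftrightarrow> signed_stable F z" for z
    using W[of "W' *v z"] inv(1) by (simp add: matrix_vector_mul_assoc)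
  have "\<exists>!k. W $ k $ i \<noteq> 0" for i
    using W W' inv by (intro column_support_singleton) auto
  then obtain f where f: "\<And>i k. W $ k $ i \<noteq> 0 \<longleftrightarrow> k = f i"
    by metis
  have col: "W *v axis i 1 = axis (f i) (W $ f i $ i)" for i
    using f by (auto simp: vec_eq_iff matrix_vector_mult_axis_nth) (auto simp: axis_def)
  have unit: "\<bar>W $ f i $ i\<bar> = 1" for i
  proof -
    have "signed_stable F (W *v axis i 1)"
      by (simp add: W signed_stable_axis)
    then have "\<bar>W $ f i $ i\<bar> \<le> 1"
      by (simp add: signed_stable_def matrix_vector_mult_axis_nth)
    moreover have "W $ f i $ i \<noteq> 0"
      by (simp add: f)
    ultimately show ?thesis
      by linarith
  qed
  have W'W: "W' $ a $ f l * W $ f l $ l = (if a = l then 1 else 0)" for a l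
  proof -
    have "(\<Sum>m\<in>UNIV. W' $ a $ m * W $ m $ l) = (\<Sum>m\<in>{f l}. W' $ a $ m * W $ m $ l)"
      using f by (intro sum.mono_neutral_right) auto
    with inv(2) show ?thesis
      by (simp add: vec_eq_iff matrix_matrix_mult_def mat_def)
  qed
  have "inj f"
  proof (rule injI)
    \<comment> \<open>The diagonal entry gives \<open>W' $ i $ f i \<noteq> 0\<close>, so entry
      \<open>(i, j)\<close> of the identity is a product of nonzero integers.\<close>
    fix i j assume "f i = f j"
    with W'W[of i i] W'W[of i j] f[of "f j" j] show "i = j"
      by (auto split: if_splits)
  qed
  then have "bij f"
    by (simp add: bij_def finite_UNIV_inj_surj)
  moreover have "{i, j} \<in> E \<longleftrightarrow> {f i, f j} \<in> F" for i j
  proof (cases "i = j")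
    case True
    with assms(1,2) show ?thesis
      by (auto simp: simple_graph_def nsets_def)
  next
    case False
    then have "f i \<noteq> f j"
      using \<open>inj f\<close> by (simp add: inj_eq)
    then have "signed_stable F (W *v (axis i 1 + axis j 1)) \<longleftrightarrow> {f i, f j} \<notin> F"
      by (simp add: matrix_vector_right_distrib col unit signed_stable_axis_add_iff)
    with False show ?thesis
      by (simp add: W signed_stable_axis_add_iff)
  qed
  ultimately show ?thesis
    by (auto simp: graph_isomorphic_def)
qed

section \<open>From isomorphisms to unimodular equivalences\<close>

text \<open>Permuting coordinates is linear, hence commutes with the convex hull, and sends the
  vector of a stable set to that of its preimage under \<open>p\<close>. Only one direction of edge
  preservation is assumed, so the lemma serves \<open>f\<close> and its inverse alike.\<close>

lemma stable_set_polytope_reindex: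
  fixes p :: "'n::finite \<Rightarrow> 'n"
  assumes "bij p" and "\<And>i j. {i, j} \<in> F \<Longrightarrow> {p i, p j} \<in> E"
    and "x \<in> stable_set_polytope E"
  shows "(\<chi> i. x $ p i) \<in> stable_set_polytope F"
proof -
  let ?L = "\<lambda>x :: real ^ 'n. \<chi> i. x $ p i"
  have "linear ?L"
    by (simp add: linear_iff vec_eq_iff)
  then have "?L ` stable_set_polytope E = convex hull (?L ` {char_vec S | S. indep S E})"
    by (simp add: stable_set_polytope_def convex_hull_linear_image)
  also have "\<dots> \<subseteq> stable_set_polytope F"
    unfolding stable_set_polytope_def
  proof (intro hull_mono subsetI)
    fix y assume "y \<in> ?L ` {char_vec S | S. indep S E}"
    then obtain S where S: "indep S E" "y = ?L (char_vec S)"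
      by blast
    then have "y = char_vec (p -` S)"
      by (simp add: char_vec_def vec_eq_iff indicator_def)
    moreover have "indep (p -` S) F"
      using S(1) assms(2) bij_is_inj[OF assms(1)] unfolding indep_def by (meson injD vimageE)
    ultimately show "y \<in> {char_vec S | S. indep S F}"
      by blast
  qed
  finally show ?thesis
    using assms(3) by blast
qed

lemma unimodularly_equivalent_if_graph_isomorphic:
  fixes E F :: "'n::finite set set"
  assumes "graph_isomorphic UNIV E UNIV F"
  shows "unimodularly_equivalent
           (unconditional (stable_set_polytope E)) (unconditional (stable_set_polytope F))"
proof -
  obtain f where f: "bij f" and edge: "\<And>i j. {i, j} \<in> E \<longleftrightarrow> {f i, f j} \<in> F"
    using assms by (auto simp: graph_isomorphic_def)
  define p where "p = inv f"
  have p: "bij p" and pf: "p (f i) = i" and fp: "f (p i) = i" for i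
    using f by (simp_all add: p_def bij_imp_bij_inv bij_is_inj bij_is_surj surj_f_inv_f)
  \<comment> \<open>\<open>undefined\<close> serves as an arbitrary fixed index; flipping that one
    coordinate when \<open>p\<close> is odd makes the determinant 1.\<close>
  define c :: "'n \<Rightarrow> int" where "c = (\<lambda>i. if i = undefined then sign p else 1)"
  define W :: "int ^ 'n ^ 'n" where "W = (\<chi> i. c i *s mat 1 $ p i)"
  have cc: "c i * c i = 1" and c_abs: "\<bar>c i\<bar> = 1" for i
    by (simp_all add: c_def sign_def)
  have "prod c UNIV = sign p"
    by (simp add: c_def)
  moreover have "p permutes UNIV"
    using p by (intro bij_imp_permutes) auto
  then have "det (\<chi> i. (mat 1 :: int ^ 'n ^ 'n) $ p i) = sign p"
    using det_permute_rows[of p "mat 1 :: int ^ 'n ^ 'n"] by simp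
  ultimately have "det W = sign p * sign p"
    unfolding W_def by (simp add: det_rows_mul)
  then have det: "det W = 1"
    by (simp add: sign_def)
  let ?L = "\<lambda>x. map_matrix real_of_int W *v x"
  have W_nth: "?L x $ k = real_of_int (c k) * x $ p k" for x k
  proof -
    have "?L x $ k = (\<Sum>j\<in>UNIV. real_of_int (W $ k $ j) * x $ j)"
      by (simp add: matrix_vector_mult_def)
    also have "\<dots> = (\<Sum>j\<in>{p k}. real_of_int (W $ k $ j) * x $ j)"
      by (intro sum.mono_neutral_right) (auto simp: W_def mat_def)
    finally show ?thesis
      by (simp add: W_def mat_def)
  qed
  have "unconditional (stable_set_polytope F) = ?L ` unconditional (stable_set_polytope E)"
  proof (intro equalityI subsetI)
    fix y assume "y \<in> unconditional (stable_set_polytope F)"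
    then have "(\<chi> i. \<bar>y $ i\<bar>) \<in> stable_set_polytope F"
      by (simp add: unconditional_def)
    from stable_set_polytope_reindex[OF f edge[THEN iffD1] this]
    have y: "(\<chi> i. \<bar>y $ f i\<bar>) \<in> stable_set_polytope E"
      by simp
    \<comment> \<open>The preimage of \<open>y\<close>: each sign is its own inverse, and
      \<open>f\<close> undoes \<open>p\<close>.\<close>
    let ?x = "\<chi> i. real_of_int (c (f i)) * y $ f i"
    have "?x \<in> unconditional (stable_set_polytope E)"
      using y c_abs by (simp add: unconditional_def abs_mult flip: of_int_abs)
    moreover have "?L ?x = y"
    proof -
      have "real_of_int (c k) * (real_of_int (c k) * y $ k) = y $ k" for k
        using cc[of k] by (metis mult.assoc mult_1 of_int_1 of_int_mult)
      then show ?thesis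
        by (simp add: vec_eq_iff W_nth fp)
    qed
    ultimately show "y \<in> ?L ` unconditional (stable_set_polytope E)"
      by (rule rev_image_eqI[OF _ sym])
  next
    fix y assume "y \<in> ?L ` unconditional (stable_set_polytope E)"
    then obtain x where "(\<chi> i. \<bar>x $ i\<bar>) \<in> stable_set_polytope E" and y: "y = ?L x"
      by (auto simp: unconditional_def)
    moreover have "{p i, p j} \<in> E" if "{i, j} \<in> F" for i j
      using that by (simp add: edge fp)
    ultimately have "(\<chi> i. \<bar>x $ p i\<bar>) \<in> stable_set_polytope F"
      using stable_set_polytope_reindex[OF p, of F E "\<chi> i. \<bar>x $ i\<bar>"] by simp
    then show "y \<in> unconditional (stable_set_polytope F)"
      using c_abs by (simp add: unconditional_def y W_nth abs_mult flip: of_int_abs)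
  qed
  moreover have "(\<chi> i. real_of_int ((0 :: int ^ 'n) $ i)) = 0"
    by (simp add: vec_eq_iff)
  ultimately show ?thesis
    unfolding unimodularly_equivalent_def using det
    by (intro exI[of _ W] exI[of _ 0]) simp
qed

theorem theorem4p9:
  fixes E\<^sub>G E\<^sub>H :: "'n::finite set set"
  assumes "perfect_graph UNIV E\<^sub>G" and "perfect_graph UNIV E\<^sub>H"
  shows "unimodularly_equivalent
           (unconditional (stable_set_polytope E\<^sub>G))
           (unconditional (stable_set_polytope E\<^sub>H))
         \<longleftrightarrow> graph_isomorphic UNIV E\<^sub>G UNIV E\<^sub>H"
proof
  have "simple_graph UNIV E\<^sub>G" "simple_graph UNIV E\<^sub>H"
    using assms by (simp_all add: perfect_graph_def)
  then show "graph_isomorphic UNIV E\<^sub>G UNIV E\<^sub>H"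
    if "unimodularly_equivalent (unconditional (stable_set_polytope E\<^sub>G))
          (unconditional (stable_set_polytope E\<^sub>H))"
    using that by (rule graph_isomorphic_if_unimodularly_equivalent)
qed (rule unimodularly_equivalent_if_graph_isomorphic)

end
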